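(* If $G$ is a $2$-connected triangle-free graph with $\delta(G)\geq 3$, then $G$ contains an edge $e=xy$ such that $\kappa(G-\{x,y\})\geq 2$.
   Context: All graphs are finite, undirected and simple. $\delta(G)$ is the minimum degree of $G$. For $U\subseteq V(G)$, $G-U$ is the subgraph induced by $V(G)\setminus U$. The connectivity $\kappa(G)$ is the minimum cardinality of a set $S\subseteq V(G)$ such that $G-S$ is disconnected or trivial (a single vertex); $G$ is $k$-connected if $\kappa(G)\geq k$. *)

theory Defs
  imports "Graph_Theory.Graph_Theory"
begin

(* Finite simple undirected graphs are the locale graph: finite, loop-free digraphs without
   parallel arcs whose arc relation is symmetric. An undirected edge xy is thus a pair of
   opposite arcs, and the degree of a vertex is its out-degree. *)

definition delete_verts :: "('a,'b) pre_digraph \<Rightarrow> 'a set \<Rightarrow> ('a,'b) pre_digraph" where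
  "delete_verts G U = G \<restriction> (verts G - U)"

(* Meaningful only if verts G is nonempty. *)
definition min_degree :: "('a,'b) pre_digraph \<Rightarrow> nat" where
  "min_degree G = Min (out_degree G ` verts G)"

(* No distinctness is required of u, v, w: it is automatic in a loop-free graph. *)
definition triangle_free :: "('a,'b) pre_digraph \<Rightarrow> bool" where
  "triangle_free G \<longleftrightarrow>
     \<not> (\<exists>u v w. u \<rightarrow>\<^bsub>G\<^esub> v \<and> v \<rightarrow>\<^bsub>G\<^esub> w \<and> w \<rightarrow>\<^bsub>G\<^esub> u)"

definition trivial_graph :: "('a,'b) pre_digraph \<Rightarrow> bool" where
  "trivial_graph G \<longleftrightarrow> card (verts G) = 1"

(* The library's connected is false for the null graph. Hence S = verts G always qualifies, so
   the minimum exists, and the null graph has connectivity 0. For other finite graphs S = verts G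
   never attains the minimum, as deleting all vertices but one leaves a trivial graph. *)
definition connectivity :: "('a,'b) pre_digraph \<Rightarrow> nat" where
  "connectivity G = (LEAST k. \<exists>S \<subseteq> verts G. card S = k \<and>
     (\<not> Digraph_Component.connected (delete_verts G S) \<or> trivial_graph (delete_verts G S)))"

definition k_connected :: "nat \<Rightarrow> ('a,'b) pre_digraph \<Rightarrow> bool" where
  "k_connected k G \<longleftrightarrow> connectivity G \<ge> k"

end

(* Choose a largest vertex set H such that G[H] is connected without cut vertex (a single vertex or
   an edge counts) and some edge avoids H; edges qualify, so H has at least two vertices. Let R be
   the complement of H. Adding an ear (a path through R joining two distinct vertices of H) keeps H
   biconnected, so by maximality no edge of R avoids the ear.
   If some r in R has two neighbours in H, then r alone is an ear, so all edges in R are incident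
   with r. A further vertex of R then also has two neighbours in H, so R is just one edge.
   Otherwise every vertex of R has at most one neighbour in H. Take a shortest ear P. If P exhausts
   R, its first vertex has a chord, which shortens P. If v in R lies off P, its neighbours on P are at
   distance exactly two by minimality and triangle-freeness, so there are just two of them; v also
   has a neighbour in H, and leaving P through v gives a shorter ear. *)

theory Submission
  imports Defs
begin

section \<open>Connected and biconnected vertex sets, and ears\<close>

definition conn_on :: "'a rel \<Rightarrow> 'a set \<Rightarrow> bool" where
  "conn_on E X \<longleftrightarrow> (\<forall>u\<in>X. \<forall>v\<in>X. (u, v) \<in> rtrancl_on X E)"

text \<open>Since \<open>conn_on\<close> holds of the empty set, single vertices and single edges
  count as biconnected.\<close>

definition biconn_on :: "'a rel \<Rightarrow> 'a set \<Rightarrow> bool" where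
  "biconn_on E X \<longleftrightarrow> conn_on E X \<and> (\<forall>v. conn_on E (X - {v}))"

abbreviation walk :: "'a rel \<Rightarrow> 'a list \<Rightarrow> bool" where
  "walk E \<equiv> successively (\<lambda>x y. (x, y) \<in> E)"

text \<open>The list \<open>xs\<close> holds only the inner vertices; the ends \<open>a\<close> and
  \<open>b\<close> are kept apart. The inner vertices may repeat: a shortest ear turns out to be a
  path anyway.\<close>

definition ear :: "'a rel \<Rightarrow> 'a set \<Rightarrow> 'a \<Rightarrow> 'a list \<Rightarrow> 'a \<Rightarrow> bool" where
  "ear E H a xs b \<longleftrightarrow> xs \<noteq> [] \<and> walk E xs \<and> set xs \<inter> H = {} \<and>
     a \<in> H \<and> b \<in> H \<and> a \<noteq> b \<and> (a, hd xs) \<in> E \<and> (last xs, b) \<in> E"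

lemma conn_on_empty [simp]: "conn_on E {}"
  by (simp add: conn_on_def)

lemma conn_on_singleton [simp]: "conn_on E {x}"
  by (simp add: conn_on_def)

lemma conn_on_Un:
  assumes "sym E" "conn_on E A" "conn_on E B" "a \<in> A" "b \<in> B" "(a, b) \<in> E"
  shows "conn_on E (A \<union> B)"
proof -
  let ?R = "rtrancl_on (A \<union> B) E"
  have A: "(u, v) \<in> ?R" if "u \<in> A" "v \<in> A" for u v
    by (rule rtrancl_on_mono[of E E A]) (use that assms(2) in \<open>simp_all add: conn_on_def\<close>)
  have B: "(u, v) \<in> ?R" if "u \<in> B" "v \<in> B" for u v
    by (rule rtrancl_on_mono[of E E B]) (use that assms(3) in \<open>simp_all add: conn_on_def\<close>)
  have ab: "(a, b) \<in> ?R"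
    using assms(4-6) by (intro converse_rtrancl_on_into_rtrancl_on[OF _ rtrancl_on_refl]) auto
  have AB: "(u, v) \<in> ?R" if "u \<in> A" "v \<in> B" for u v
    by (rule rtrancl_on_trans[OF rtrancl_on_trans[OF A[OF that(1) assms(4)] ab] B[OF assms(5) that(2)]])
  then have "(v, u) \<in> ?R" if "u \<in> A" "v \<in> B" for u v
    using that rtrancl_on_sym[OF assms(1)] by (blast dest: symD)
  with A B AB show ?thesis
    unfolding conn_on_def by blast
qed

lemma conn_on_walk:
  assumes "sym E" "walk E xs"
  shows "conn_on E (set xs)"
  using assms(2)
proof (induction xs)
  case (Cons x xs)
  show ?case
  proof (cases "xs = []")
    case False
    with Cons have "conn_on E (set xs)" "(x, hd xs) \<in> E"
      by (auto simp: successively_Cons)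
    with False conn_on_Un[OF assms(1), of "{x}" "set xs" x "hd xs"] show ?thesis
      by simp
  qed simp
qed simp

lemma biconn_on_edge:
  assumes "sym E" "(x, y) \<in> E"
  shows "biconn_on E {x, y}"
proof -
  have "conn_on E {x, y}"
    using conn_on_Un[OF assms(1), of "{x}" "{y}" x y] assms(2) by (simp add: insert_commute)
  moreover have "{x, y} - {v} \<in> {{x, y}, {x}, {y}, {}}" for v
    by auto
  ultimately show ?thesis
    unfolding biconn_on_def by (metis conn_on_empty conn_on_singleton empty_iff insert_iff)
qed

text \<open>If the deleted vertex \<open>v\<close> is off the ear, the whole ear still hangs on
  \<open>H - {v}\<close> at an end other than \<open>v\<close>. If \<open>v\<close> is on the ear,
  the two remaining pieces hang on the intact \<open>H\<close>, one at each end.\<close>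

lemma biconn_on_ear:
  assumes "sym E" "biconn_on E H" "ear E H a xs b" "distinct xs"
  shows "biconn_on E (H \<union> set xs)"
proof -
  have H: "conn_on E H" "\<And>v. conn_on E (H - {v})"
    using assms(2) by (auto simp: biconn_on_def)
  have e: "xs \<noteq> []" "walk E xs" "set xs \<inter> H = {}" "a \<in> H" "b \<in> H" "a \<noteq> b"
    "(a, hd xs) \<in> E" "(b, last xs) \<in> E"
    using assms(1,3) by (auto simp: ear_def dest: symD)
  have xs: "conn_on E (set xs)"
    using conn_on_walk assms(1) e(2) .
  have "conn_on E (H \<union> set xs - {v})" for v
  proof (cases "v \<in> set xs")
    case False
    then have eq: "H \<union> set xs - {v} = (H - {v}) \<union> set xs"
      by auto
    show ?thesis
    proof (cases "a = v")
      case True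
      then show ?thesis
        unfolding eq using e by (intro conn_on_Un[OF assms(1) H(2) xs, of b _ "last xs"]) auto
    next
      case False
      then show ?thesis
        unfolding eq using e by (intro conn_on_Un[OF assms(1) H(2) xs, of a _ "hd xs"]) auto
    qed
  next
    case True
    then obtain ys zs where s: "xs = ys @ v # zs"
      by (auto simp: in_set_conv_decomp)
    have w: "walk E ys" "walk E zs"
      using e(2) unfolding s by (auto simp: successively_append_iff successively_Cons)
    have 1: "conn_on E (H \<union> set ys)"
    proof (cases "ys = []")
      case False
      then show ?thesis
        using e s by (intro conn_on_Un[OF assms(1) H(1) conn_on_walk[OF assms(1) w(1)], of a "hd ys"]) auto
    qed (simp add: H)
    have 2: "conn_on E (H \<union> set ys \<union> set zs)"
    proof (cases "zs = []")
      case False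
      then show ?thesis
        using e s by (intro conn_on_Un[OF assms(1) 1 conn_on_walk[OF assms(1) w(2)], of b "last zs"]) auto
    qed (simp add: 1)
    \<comment> \<open>Distinctness of \<open>xs\<close> enters here: \<open>v\<close> recurs neither
      in \<open>ys\<close> nor in \<open>zs\<close>.\<close>
    have "H \<union> set xs - {v} = H \<union> set ys \<union> set zs"
      using True s assms(4) e(3) by auto
    then show ?thesis
      using 2 by simp
  qed
  moreover have "conn_on E (H \<union> set xs)"
    using e by (intro conn_on_Un[OF assms(1) H(1) xs, of a "hd xs"]) auto
  ultimately show ?thesis
    by (simp add: biconn_on_def)
qed

section \<open>Walks and shortest ears\<close>

lemma walk_if_rtrancl_on:
  assumes "(u, v) \<in> rtrancl_on X E"
  shows "\<exists>xs. xs \<noteq> [] \<and> walk E xs \<and> set xs \<subseteq> X \<and> hd xs = u \<and> last xs = v"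
  using assms
proof (induction rule: rtrancl_on_induct)
  case base
  then show ?case by (intro exI[of _ "[u]"]) simp
next
  case (step y z)
  then obtain xs where "xs \<noteq> []" "walk E xs" "set xs \<subseteq> X" "hd xs = u" "last xs = y"
    by blast
  with step show ?case
    by (intro exI[of _ "xs @ [z]"]) (simp add: successively_append_iff)
qed

lemma walk_subset:
  assumes "walk E xs" "E \<subseteq> V \<times> V" "hd xs \<in> V"
  shows "set xs \<subseteq> V"
  using assms(1,3)
proof (induction xs)
  case (Cons x xs)
  then show ?case
    using assms(2) by (cases xs) auto
qed simp

lemma walk_take: "walk E xs \<Longrightarrow> walk E (take n xs)"
  using successively_append_iff[of _ "take n xs" "drop n xs"] by simp

lemma walk_drop: "walk E xs \<Longrightarrow> walk E (drop n xs)"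
  using successively_append_iff[of _ "take n xs" "drop n xs"] by simp

lemma last_take_Suc: "i < length xs \<Longrightarrow> last (take (Suc i) xs) = xs ! i"
  by (simp add: take_Suc_conv_app_nth)

text \<open>Comparing the pairs as sets leaves open which of \<open>x\<close> and \<open>y\<close>
  comes first on the list, so that \<open>i < j\<close> may be assumed.\<close>

lemma set_nth_pair_cases:
  assumes "x \<in> set xs" "y \<in> set xs" "x \<noteq> y"
  obtains i j where "i < j" "j < length xs" "{xs ! i, xs ! j} = {x, y}"
proof -
  obtain i j where "i < length xs" "xs ! i = x" "j < length xs" "xs ! j = y"
    using assms by (auto simp: in_set_conv_nth)
  with assms that[of i j] that[of j i] show thesis
    by (cases i j rule: linorder_cases) auto
qed

text \<open>Between two visits to the same vertex \<open>y\<close> the walk can be cut out, which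
  shortens the ear.\<close>

lemma shortest_ear_distinct:
  assumes "ear E H a xs b" "\<And>a' xs' b'. ear E H a' xs' b' \<Longrightarrow> length xs \<le> length xs'"
  shows "distinct xs"
proof (rule ccontr)
  assume "\<not> distinct xs"
  then obtain p q r y where s: "xs = p @ [y] @ q @ [y] @ r"
    using not_distinct_decomp by blast
  have "walk E ((p @ [y]) @ (q @ [y] @ r))" "walk E ((p @ [y] @ q) @ (y # r))"
    using assms(1) s by (simp_all add: ear_def)
  then have "walk E (p @ [y])" "walk E (y # r)"
    unfolding successively_append_iff[of _ "p @ [y]" "q @ [y] @ r"]
      successively_append_iff[of _ "p @ [y] @ q" "y # r"] by blast+
  then have "walk E (p @ y # r)"
    by (simp add: successively_append_iff)
  moreover have "hd (p @ y # r) = hd xs" "last (p @ y # r) = last xs" "set (p @ y # r) \<subseteq> set xs"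
    unfolding s by (cases p; auto)+
  ultimately have "ear E H a (p @ y # r) b"
    using assms(1) by (auto simp: ear_def)
  with assms(2) s show False
    by fastforce
qed

section \<open>Triangle-free relations of minimum degree three without cut vertices\<close>

locale triangle_free_2conn =
  fixes V :: "'a set" and E :: "'a rel"
  assumes fin: "finite V" and sub: "E \<subseteq> V \<times> V" and symE: "sym E"
    and tf: "\<And>u v w. \<lbrakk>(u, v) \<in> E; (v, w) \<in> E\<rbrakk> \<Longrightarrow> (w, u) \<notin> E"
    and deg: "\<And>v. v \<in> V \<Longrightarrow> card (E `` {v}) \<ge> 3"
    and nonempty: "V \<noteq> {}"
    and conn: "\<And>v. conn_on E (V - {v})"
begin

lemma E_sym: "(x, y) \<in> E \<Longrightarrow> (y, x) \<in> E"
  using symE by (rule symD)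

text \<open>A loop is a degenerate triangle: \<open>u = v = w\<close> in \<open>tf\<close>.\<close>

lemma irrefl: "(x, x) \<notin> E"
  using tf by blast

lemma finite_nbrs: "finite (E `` {v})"
  using fin sub by (auto intro: finite_subset)

lemma nbr_notin:
  assumes "v \<in> V" "finite A" "card (E `` {v} \<inter> A) < 3"
  obtains w where "(v, w) \<in> E" "w \<notin> A"
proof -
  have "\<not> E `` {v} \<subseteq> A"
    using deg[OF assms(1)] assms(3) by (auto simp: Int_absorb2)
  then show thesis
    using that by auto
qed

text \<open>At most one of the three or more neighbours is lost to \<open>H\<close>. The lemma
  serves both for the maximal set and for a singleton.\<close>

lemma two_nbrs_notin:
  assumes "v \<in> V" "\<And>a b. \<lbrakk>a \<in> H; b \<in> H; (v, a) \<in> E; (v, b) \<in> E\<rbrakk> \<Longrightarrow> a = b"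
  obtains x y where "(v, x) \<in> E" "x \<notin> H" "(v, y) \<in> E" "y \<notin> H" "x \<noteq> y"
proof -
  have "card (E `` {v} \<inter> H) \<le> 1"
    using finite_nbrs assms(2) by (subst card_le_Suc0_iff_eq[unfolded One_nat_def[symmetric]]) auto
  then have "card (E `` {v} - H) \<ge> 2"
    using deg[OF assms(1)] card_Diff_subset_Int[of "E `` {v}" H] finite_nbrs by simp
  then obtain x y where "x \<in> E `` {v} - H" "y \<in> E `` {v} - H" "x \<noteq> y"
    by (metis card_2_iff' card_le_Suc0_iff_eq finite_Diff finite_nbrs not_less_eq_eq numeral_2_eq_2)
  then show thesis
    using that by auto
qed

lemma ex_edge: obtains x y where "(x, y) \<in> E"
proof -
  obtain v where "v \<in> V"
    using nonempty by auto
  then show thesis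
    using nbr_notin[of v "{}"] that by auto
qed

text \<open>Take a neighbour \<open>v\<close> of \<open>a\<close> other than \<open>b\<close>, then
  one of its at least three neighbours outside \<open>{a, b}\<close>. This makes a single edge a
  legitimate start for the maximal choice.\<close>

lemma edge_outside_edge:
  assumes "(a, b) \<in> E"
  obtains x y where "(x, y) \<in> E" "{x, y} \<inter> {a, b} = {}"
proof -
  have ab: "a \<in> V" "b \<in> V"
    using assms sub by auto
  obtain v where v: "(a, v) \<in> E" "v \<notin> {b}"
    using nbr_notin[of a "{b}"] ab card_mono[of "{b}" "E `` {a} \<inter> {b}"] by auto
  have "card (E `` {v} \<inter> {a, b}) \<le> card {a, b}"
    by (intro card_mono) auto
  also have "card {a, b} < 3"
    by (simp add: card_insert_if)
  finally obtain w where "(v, w) \<in> E" "w \<notin> {a, b}"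
    using nbr_notin[of v "{a, b}"] v sub by blast
  with v irrefl that[of v w] show thesis
    by auto
qed

text \<open>The component \<open>K\<close> of \<open>r\<close> outside \<open>H\<close> has
  neighbours at two different vertices of \<open>H\<close>, for otherwise one vertex of
  \<open>H\<close> would separate \<open>r\<close> from the rest. A walk inside \<open>K\<close>
  links the two exits.\<close>

lemma ex_ear:
  assumes "H \<subseteq> V" "c \<in> H" "d \<in> H" "c \<noteq> d" "r \<in> V - H"
  shows "\<exists>a xs b. ear E H a xs b"
proof -
  define K where "K = {v. (r, v) \<in> rtrancl_on (V - H) E}"
  have leave: "\<exists>k h. k \<in> K \<and> h \<in> H \<and> h \<noteq> z \<and> (k, h) \<in> E" if "z \<in> H" for z
  proof (rule ccontr)
    assume neg: "\<not> ?thesis"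
    obtain t where t: "t \<in> H" "t \<noteq> z"
      using assms by metis
    have "(r, t) \<in> rtrancl_on (V - {z}) E"
      using conn[of z] t assms that by (auto simp: conn_on_def)
    \<comment> \<open>Without an exit other than \<open>z\<close>, a walk from \<open>r\<close>
      avoiding \<open>z\<close> can never enter \<open>H\<close>, although it ends in
      \<open>t\<close>.\<close>
    then have "t \<in> K"
    proof (induction rule: rtrancl_on_induct)
      case base
      then show ?case using assms by (simp add: K_def)
    next
      case (step x y)
      then have "y \<notin> H"
        using neg by auto
      with step show ?case
        unfolding K_def by (auto intro: rtrancl_on_into_rtrancl_on)
    qed
    then show False
      using t in_rtrancl_on_in_F(2) unfolding K_def by fastforce
  qed
  obtain k a where k: "k \<in> K" "a \<in> H" "(k, a) \<in> E"
    using leave assms(2) by blast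
  obtain l b where l: "l \<in> K" "b \<in> H" "b \<noteq> a" "(l, b) \<in> E"
    using leave[OF k(2)] by blast
  have "(k, r) \<in> rtrancl_on (V - H) E"
    using k rtrancl_on_sym[OF symE] unfolding K_def by (auto dest: symD)
  with l have "(k, l) \<in> rtrancl_on (V - H) E"
    unfolding K_def by (auto intro: rtrancl_on_trans)
  then obtain xs where "xs \<noteq> []" "walk E xs" "set xs \<subseteq> V - H" "hd xs = k" "last xs = l"
    using walk_if_rtrancl_on by metis
  with k l E_sym have "ear E H a xs b"
    unfolding ear_def by auto
  then show ?thesis
    by blast
qed

text \<open>The case where no outside vertex has two neighbours in \<open>H\<close>;
  \<open>indep\<close> is what maximality of \<open>H\<close> will supply. Every rerouting of the
  ear contradicts \<open>short\<close>.\<close>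

lemma shortest_ear_dominates_False:
  assumes "ear E H a xs b" "set xs \<subseteq> V"
    and short: "\<And>a' xs' b'. ear E H a' xs' b' \<Longrightarrow> length xs \<le> length xs'"
    and single: "\<And>r c d. \<lbrakk>r \<in> V - H; c \<in> H; d \<in> H; (r, c) \<in> E; (r, d) \<in> E\<rbrakk> \<Longrightarrow> c = d"
    and indep: "\<And>x y. \<lbrakk>x \<in> V - H - set xs; y \<in> V - H - set xs\<rbrakk> \<Longrightarrow> (x, y) \<notin> E"
  shows False
proof -
  have e: "xs \<noteq> []" "walk E xs" "set xs \<inter> H = {}" "a \<in> H" "b \<in> H" "a \<noteq> b"
    "(a, hd xs) \<in> E" "(last xs, b) \<in> E"
    using assms(1) by (auto simp: ear_def)
  have step: "(xs ! i, xs ! Suc i) \<in> E" if "Suc i < length xs" for i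
    using successively_nth[OF e(2) that] .
  show False
  proof (cases "V - H \<subseteq> set xs")
    case True
    have hd: "hd xs \<in> V" "hd xs \<notin> H"
      using e(3) assms(2) hd_in_set[OF e(1)] by blast+
    obtain x y where xy: "(hd xs, x) \<in> E" "x \<notin> H" "(hd xs, y) \<in> E" "y \<notin> H" "x \<noteq> y"
      using two_nbrs_notin[of "hd xs" H] single hd by blast
    then have "x \<in> set xs" "y \<in> set xs"
      using True sub by auto
    then obtain i j where ij: "i < j" "j < length xs" "{xs ! i, xs ! j} = {x, y}"
      using set_nth_pair_cases xy(5) by metis
    \<comment> \<open>The first vertex is not its own neighbour, so \<open>j \<ge> 2\<close> and the
      chord to position \<open>j\<close> skips a vertex.\<close>
    have "i \<noteq> 0"
      using ij xy irrefl hd_conv_nth[OF e(1)] by (metis doubleton_eq_iff)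
    have "(hd xs, xs ! j) \<in> E"
      using ij(3) xy by (metis doubleton_eq_iff)
    then have "ear E H a (hd xs # drop j xs) b"
      using e ij(2) hd(2) set_drop_subset[of j xs]
      by (auto simp: ear_def successively_Cons walk_drop hd_drop_conv_nth)
    from short[OF this] ij \<open>i \<noteq> 0\<close> show False
      by simp
  next
    case False
    then obtain v where v: "v \<in> V" "v \<notin> H" "v \<notin> set xs"
      by auto
    \<comment> \<open>Replacing the stretch strictly between \<open>i\<close> and \<open>j\<close>
      by \<open>v\<close> must not shorten the ear, so \<open>j \<le> i + 2\<close>;
      \<open>j = i + 1\<close> would close a triangle.\<close>
    have gap: "j = Suc (Suc i)" if "i < j" "j < length xs" "(v, xs ! i) \<in> E" "(v, xs ! j) \<in> E" for i j
    proof -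
      have "ear E H a (take (Suc i) xs @ v # drop j xs) b"
        using e that v set_drop_subset[of j xs] set_take_subset[of "Suc i" xs]
          E_sym[OF that(3)]
        by (auto simp: ear_def successively_Cons successively_append_iff walk_drop walk_take
            hd_drop_conv_nth last_take_Suc)
      from short[OF this] that have "j \<le> Suc (Suc i)"
        by simp
      moreover have "j \<noteq> Suc i"
        using that step[of i] tf[of v "xs ! i" "xs ! j"] E_sym by blast
      ultimately show ?thesis
        using that(1) by simp
    qed
    obtain x y where xy: "(v, x) \<in> E" "x \<notin> H" "(v, y) \<in> E" "y \<notin> H" "x \<noteq> y"
      using two_nbrs_notin[of v H] single v by blast
    have on: "z \<in> set xs" if "(v, z) \<in> E" "z \<notin> H" for z
      using indep[of v z] v that sub by auto
    obtain i j where ij: "i < j" "j < length xs" "{xs ! i, xs ! j} = {x, y}"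
      using set_nth_pair_cases[OF on[OF xy(1,2)] on[OF xy(3,4)] xy(5)] .
    have vi: "(v, xs ! i) \<in> E" and vj: "(v, xs ! j) \<in> E"
      using ij(3) xy by (metis doubleton_eq_iff)+
    have j: "j = Suc (Suc i)"
      using gap ij vi vj by blast
    have "card (E `` {v} \<inter> {x, y}) \<le> card {x, y}"
      by (intro card_mono) auto
    also have "card {x, y} < 3"
      by (simp add: card_insert_if)
    finally obtain h where h: "(v, h) \<in> E" "h \<notin> {x, y}"
      using nbr_notin[of v "{x, y}"] v by blast
    \<comment> \<open>A third neighbour on the ear is impossible: three positions cannot be pairwise
      at distance two.\<close>
    have "h \<in> H"
    proof (rule ccontr)
      assume "h \<notin> H"
      then obtain k where k: "k < length xs" "xs ! k = h"
        using on[OF h(1)] by (auto simp: in_set_conv_nth)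
      have vk: "(v, xs ! k) \<in> E"
        using k h by simp
      have "k \<noteq> i" "k \<noteq> j"
        using k h ij(3) by auto
      then consider "k < j" | "i < k" "j < k"
        using ij(1) by linarith
      then show False
      proof cases
        case 1
        with gap[OF 1 ij(2) vk vj] j \<open>k \<noteq> i\<close> show False
          by simp
      next
        case 2
        with gap[OF 2(1) k(1) vi vk] j \<open>k \<noteq> j\<close> show False
          by simp
      qed
    qed
    show False
    \<comment> \<open>The new ear through \<open>v\<close> and \<open>h\<close> must have distinct
      ends. If \<open>h \<noteq> b\<close>, the part up to position \<open>j - 1 \<ge> 1\<close> is
      traded for \<open>v\<close>; if \<open>h = b\<close>, then \<open>h \<noteq> a\<close> and the
      part from \<open>i + 1\<close> on, at least two vertices, is traded for
      \<open>v\<close>.\<close>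
    proof (cases "h = b")
      case False
      have "ear E H h (v # drop j xs) b"
        using e ij(2) v h(1) \<open>h \<in> H\<close> False vj E_sym[OF h(1)] set_drop_subset[of j xs]
        by (auto simp: ear_def successively_Cons walk_drop hd_drop_conv_nth)
      from short[OF this] ij j show False
        by simp
    next
      case True
      have "ear E H a (take (Suc i) xs @ [v]) h"
        using e ij v h(1) \<open>h \<in> H\<close> True E_sym[OF vi] set_take_subset[of "Suc i" xs]
        by (auto simp: ear_def successively_append_iff walk_take last_take_Suc)
      from short[OF this] ij j show False
        by simp
    qed
  qed
qed

lemma biconn_edge_deletion:
  obtains x y where "(x, y) \<in> E" "biconn_on E (V - {x, y})"
proof -
  define good where "good H \<longleftrightarrow> H \<subseteq> V \<and> biconn_on E H \<and> (\<exists>(x, y) \<in> E. x \<notin> H \<and> y \<notin> H)" for H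
  obtain a0 b0 where e0: "(a0, b0) \<in> E"
    using ex_edge .
  then have g0: "good {a0, b0}"
  proof -
    obtain x y where "(x, y) \<in> E" "{x, y} \<inter> {a0, b0} = {}"
      using edge_outside_edge[OF e0] .
    then show ?thesis
      using biconn_on_edge[OF symE e0] e0 sub by (auto simp: good_def)
  qed
  have "card H \<le> card V" if "good H" for H
    using that fin by (auto simp: good_def intro: card_mono)
  then obtain H where H: "good H" and max: "\<And>H'. good H' \<Longrightarrow> card H' \<le> card H"
    using ex_has_greatest_nat[of good "{a0, b0}" card "Suc (card V)"] g0
    by (metis le_imp_less_Suc)
  have HV: "H \<subseteq> V" "biconn_on E H"
    using H by (auto simp: good_def)
  have finH: "finite H"
    using HV fin finite_subset by blast
  obtain x y where xy: "(x, y) \<in> E" "x \<notin> H" "y \<notin> H"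
    using H by (auto simp: good_def)
  have "a0 \<noteq> b0"
    using e0 irrefl by auto
  then have "card H \<ge> 2"
    using max[OF g0] by simp
  then obtain c d where cd: "c \<in> H" "d \<in> H" "c \<noteq> d"
    using finH by (metis card_le_Suc0_iff_eq not_less_eq_eq numeral_2_eq_2)
  \<comment> \<open>Otherwise \<open>H \<union> set xs\<close> would be \<open>good\<close>, and it
    is larger than \<open>H\<close> because an ear has an inner vertex.\<close>
  have indep: "(u, w) \<notin> E" if "ear E H a xs b" "distinct xs" "set xs \<subseteq> V"
    "u \<in> V - H - set xs" "w \<in> V - H - set xs" for a xs b u w
  proof
    assume "(u, w) \<in> E"
    with that HV have "good (H \<union> set xs)"
      using biconn_on_ear[OF symE HV(2)] unfolding good_def by blast
    from max[OF this] have "H \<union> set xs = H"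
      using finH by (intro card_seteq[symmetric]) auto
    with that(1) show False
      unfolding ear_def by (metis Int_absorb2 Un_upper2 set_empty)
  qed
  \<comment> \<open>A vertex \<open>r\<close> with two neighbours in \<open>H\<close> is by itself
    the ear \<open>[r]\<close>.\<close>
  have star': "u = r \<or> w = r" if "r \<in> V - H" "a \<in> H" "b \<in> H" "a \<noteq> b" "(r, a) \<in> E" "(r, b) \<in> E"
    "(u, w) \<in> E" "u \<notin> H" "w \<notin> H" for r a b u w
    using indep[of a "[r]" b u w] that E_sym sub by (auto simp: ear_def)
  have "\<exists>r\<in>V - H. \<exists>a\<in>H. \<exists>b\<in>H. a \<noteq> b \<and> (r, a) \<in> E \<and> (r, b) \<in> E"
  proof (rule ccontr)
    assume neg: "\<not> ?thesis"
    obtain a xs b where ear: "ear E H a xs b"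
      and short: "\<And>a' xs' b'. ear E H a' xs' b' \<Longrightarrow> length xs \<le> length xs'"
    proof -
      obtain a' xs' b' where "ear E H a' xs' b'"
        using ex_ear[OF HV(1) cd, of x] xy sub by auto
      then show thesis
        using that ex_has_least_nat[of "\<lambda>xs. \<exists>a b. ear E H a xs b" xs' length] by blast
    qed
    have xsV: "set xs \<subseteq> V"
      using ear walk_subset[OF _ sub] sub by (auto simp: ear_def)
    have dist: "distinct xs"
      by (rule shortest_ear_distinct[OF ear]) (rule short)
    show False
    proof (rule shortest_ear_dominates_False[OF ear xsV])
      show "length xs \<le> length xs'" if "ear E H a' xs' b'" for a' xs' b'
        using that by (rule short)
      show "c = d" if "r \<in> V - H" "c \<in> H" "d \<in> H" "(r, c) \<in> E" "(r, d) \<in> E" for r c d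
        using neg that by blast
    qed (rule indep[OF ear dist xsV])
  qed
  then obtain r a b where r: "r \<in> V" "r \<notin> H" "a \<in> H" "b \<in> H" "a \<noteq> b" "(r, a) \<in> E" "(r, b) \<in> E"
    by auto
  have star: "u = r \<or> w = r" if "(u, w) \<in> E" "u \<notin> H" "w \<notin> H" for u w
    using star' r that by blast
  \<comment> \<open>By \<open>star\<close> the edge \<open>xy\<close> outside \<open>H\<close> is
    incident with \<open>r\<close>; its other end serves as \<open>s\<close>.\<close>
  obtain s where s: "(r, s) \<in> E" "s \<notin> H"
    using star[OF xy] xy E_sym by blast
  \<comment> \<open>By \<open>star\<close>, all neighbours of a further vertex \<open>t\<close>
    except possibly \<open>r\<close> lie in \<open>H\<close>. Then \<open>[t]\<close> is an ear too,
    but the edge from \<open>r\<close> to \<open>s\<close> avoids it.\<close>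
  have "t \<in> {r, s}" if t: "t \<in> V" "t \<notin> H" for t
  proof (rule ccontr)
    assume ts: "t \<notin> {r, s}"
    obtain c d where "(t, c) \<in> E" "c \<notin> {r}" "(t, d) \<in> E" "d \<notin> {r}" "c \<noteq> d"
      using two_nbrs_notin[of t "{r}"] t by blast
    moreover from this have "c \<in> H" "d \<in> H"
      using star t ts by blast+
    ultimately show False
      using star' t ts r s by blast
  qed
  then have "H = V - {r, s}"
    using HV r s by auto
  with HV that s show thesis
    by auto
qed

text \<open>Adjacent vertices share no neighbour, so their further neighbours, at least two each,
  make at least four vertices. Biconnectedness alone does not exclude a remainder too small for
  connectivity two.\<close>

lemma card_delete_edge:
  assumes "(x, y) \<in> E"
  shows "card (V - {x, y}) \<ge> 3"
proof -
  let ?A = "E `` {x} - {y}" and ?B = "E `` {y} - {x}"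
  have "x \<in> V" "y \<in> V"
    using assms sub by auto
  then have "card ?A \<ge> 2" "card ?B \<ge> 2"
    using deg[of x] deg[of y] diff_card_le_card_Diff[of "{y}" "E `` {x}"]
      diff_card_le_card_Diff[of "{x}" "E `` {y}"] by auto
  moreover have "?A \<inter> ?B = {}"
    using tf[OF assms] E_sym by blast
  ultimately have "card (?A \<union> ?B) \<ge> 4"
    using finite_nbrs by (subst card_Un_disjoint) auto
  moreover have "?A \<union> ?B \<subseteq> V - {x, y}"
    using sub irrefl by auto
  ultimately show ?thesis
    using card_mono[of "V - {x, y}" "?A \<union> ?B"] fin by simp
qed

end

section \<open>Translation to the graph library and to connectivity\<close>

lemma rtrancl_on_restrict: "rtrancl_on X (E \<inter> X \<times> X) = rtrancl_on X E"
proof (rule set_eqI; clarify)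
  fix u v
  have "(u, v) \<in> rtrancl_on X (E \<inter> X \<times> X)" if "(u, v) \<in> rtrancl_on X E"
    using that by (induction rule: rtrancl_on_induct) (auto intro: rtrancl_on_into_rtrancl_on)
  then show "(u, v) \<in> rtrancl_on X (E \<inter> X \<times> X) \<longleftrightarrow> (u, v) \<in> rtrancl_on X E"
    using rtrancl_on_mono[of "E \<inter> X \<times> X" E X X] by auto
qed

text \<open>The library defines connectedness through the symmetric closure, which adds nothing to a
  symmetric arc relation. Nonemptiness is demanded separately because \<open>conn_on\<close> admits
  the empty set.\<close>

lemma connected_induce_iff:
  assumes "graph G"
  shows "Digraph_Component.connected (G \<restriction> X) \<longleftrightarrow> X \<noteq> {} \<and> conn_on (arcs_ends G) X"
proof -
  interpret graph G by fact
  have "parcs (mk_symmetric (G \<restriction> X)) = arcs_ends G \<inter> X \<times> X"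
  proof -
    have "parcs (mk_symmetric G) = arcs_ends G"
      by (rule adj_mk_symmetric_eq[OF sym_arcs])
    then show ?thesis
      by (auto simp: parcs_mk_symmetric)
  qed
  then have "reachable (mk_symmetric (G \<restriction> X)) u v \<longleftrightarrow> (u, v) \<in> rtrancl_on X (arcs_ends G)" for u v
    by (simp add: reachable_def rtrancl_on_restrict)
  then show ?thesis
    by (simp add: Digraph_Component.connected_def strongly_connected_def conn_on_def)
qed

lemma delete_verts_delete_verts:
  "delete_verts (delete_verts G U) S = G \<restriction> (verts G - U - S)"
  by (auto simp: delete_verts_def induce_subgraph_def)

lemma delete_verts_empty:
  assumes "graph G"
  shows "delete_verts G {} = G"
proof -
  interpret graph G by fact
  have "{e \<in> arcs G. tail G e \<in> verts G \<and> head G e \<in> verts G} = arcs G"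
    by auto
  then show ?thesis
    by (simp add: delete_verts_def induce_subgraph_def)
qed

text \<open>Used with \<open>U = {}\<close> to unpack the hypothesis and with
  \<open>U = {x, y}\<close> to obtain the conclusion. The bound of three vertices says that deleting
  at most one vertex leaves neither a null nor a trivial graph.\<close>

lemma connectivity_ge_2_iff:
  assumes "graph G"
  shows "connectivity (delete_verts G U) \<ge> 2 \<longleftrightarrow>
    card (verts G - U) \<ge> 3 \<and> biconn_on (arcs_ends G) (verts G - U)"
proof -
  interpret graph G by fact
  define W where "W = verts G - U"
  define Q where "Q S \<longleftrightarrow> W - S = {} \<or> \<not> conn_on (arcs_ends G) (W - S) \<or> card (W - S) = 1" for S
  have fin: "finite W"
    by (simp add: W_def)
  have "verts (delete_verts G U) = W"
    by (simp add: delete_verts_def W_def)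
  then have conn: "connectivity (delete_verts G U) = (LEAST k. \<exists>S\<subseteq>W. card S = k \<and> Q S)"
    unfolding connectivity_def delete_verts_delete_verts trivial_graph_def
      connected_induce_iff[OF assms] Q_def W_def by simp
  \<comment> \<open>Deleting all of \<open>W\<close> qualifies, so the \<open>LEAST\<close> is
    attained.\<close>
  have ex: "\<exists>S\<subseteq>W. card S = card W \<and> Q S"
    by (auto simp: Q_def)
  have "connectivity (delete_verts G U) \<ge> 2 \<longleftrightarrow> (\<forall>S\<subseteq>W. Q S \<longrightarrow> card S \<ge> 2)"
    unfolding conn
  proof safe
    fix S assume "2 \<le> (LEAST k. \<exists>S\<subseteq>W. card S = k \<and> Q S)" "S \<subseteq> W" "Q S"
    moreover from this have "(LEAST k. \<exists>S\<subseteq>W. card S = k \<and> Q S) \<le> card S"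
      by (intro Least_le) blast
    ultimately show "card S \<ge> 2"
      by simp
  next
    assume "\<forall>S\<subseteq>W. Q S \<longrightarrow> card S \<ge> 2"
    then show "2 \<le> (LEAST k. \<exists>S\<subseteq>W. card S = k \<and> Q S)"
      using LeastI[of "\<lambda>k. \<exists>S\<subseteq>W. card S = k \<and> Q S", OF ex] by auto
  qed
  also have "\<dots> \<longleftrightarrow> \<not> Q {} \<and> (\<forall>v\<in>W. \<not> Q {v})"
  proof (intro iffI allI impI; (elim conjE)?)
    assume *: "\<forall>S\<subseteq>W. Q S \<longrightarrow> card S \<ge> 2"
    show "\<not> Q {} \<and> (\<forall>v\<in>W. \<not> Q {v})"
      using *[rule_format, of "{}"] *[rule_format, of "{v}" for v] by auto
  next
    fix S assume "\<not> Q {}" "\<forall>v\<in>W. \<not> Q {v}" "S \<subseteq> W" "Q S"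
    moreover have "finite S"
      using \<open>S \<subseteq> W\<close> fin finite_subset by blast
    ultimately have "card S \<noteq> 0" "card S \<noteq> 1"
      by (auto simp: card_1_singleton_iff)
    then show "card S \<ge> 2"
      by simp
  qed
  also have "\<dots> \<longleftrightarrow> card W \<ge> 3 \<and> biconn_on (arcs_ends G) W"
  proof
    assume *: "\<not> Q {} \<and> (\<forall>v\<in>W. \<not> Q {v})"
    then obtain v where "v \<in> W"
      by (auto simp: Q_def)
    with * have "W - {v} \<noteq> {}" "card (W - {v}) \<noteq> 1"
      by (auto simp: Q_def)
    then have "card (W - {v}) \<ge> 2"
      using fin by (metis card_0_eq finite_Diff less_2_cases not_le One_nat_def)
    then have "card W \<ge> 3"
      using \<open>v \<in> W\<close> fin by simp
    \<comment> \<open>For \<open>v\<close> outside \<open>W\<close> nothing is deleted, and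
      \<open>\<not> Q {}\<close> applies.\<close>
    moreover have "conn_on (arcs_ends G) (W - {v})" for v
      using * by (cases "v \<in> W") (auto simp: Q_def)
    ultimately show "card W \<ge> 3 \<and> biconn_on (arcs_ends G) W"
      using * by (auto simp: biconn_on_def Q_def)
  next
    assume *: "card W \<ge> 3 \<and> biconn_on (arcs_ends G) W"
    have "card (W - {v}) \<ge> 2" for v
      using * diff_card_le_card_Diff[of "{v}" W] by simp linarith
    then have "W - {v} \<noteq> {} \<and> card (W - {v}) \<noteq> 1" for v
      by (metis card.empty not_numeral_le_zero numeral_le_one_iff semiring_norm(69))
    with * show "\<not> Q {} \<and> (\<forall>v\<in>W. \<not> Q {v})"
      by (auto simp: Q_def biconn_on_def)
  qed
  finally show ?thesis
    by (simp add: W_def)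
qed

text \<open>The out-degree counts arcs; without parallel arcs \<open>head G\<close> is injective on
  those leaving \<open>v\<close>, so it counts neighbours as well.\<close>

lemma card_nbrs_ge_min_degree:
  assumes "graph G" "v \<in> verts G"
  shows "card (arcs_ends G `` {v}) \<ge> min_degree G"
proof -
  interpret graph G by fact
  have "inj_on (head G) (out_arcs G v)"
    by (rule inj_onI) (auto simp: out_arcs_def arc_to_ends_def intro: no_multi_arcs)
  moreover have "arcs_ends G `` {v} = head G ` out_arcs G v"
    by (auto simp: arcs_ends_conv out_arcs_def)
  ultimately have "card (arcs_ends G `` {v}) = out_degree G v"
    by (simp add: card_image out_degree_def)
  then show ?thesis
    using assms(2) by (simp add: min_degree_def)
qed

theorem proposition1p1:
  fixes G :: "('a,'b) pre_digraph"
  assumes "graph G"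
    and "k_connected 2 G"
    and "triangle_free G"
    and "min_degree G \<ge> 3"
  shows "\<exists>x y. x \<rightarrow>\<^bsub>G\<^esub> y \<and> connectivity (delete_verts G {x, y}) \<ge> 2"
proof -
  interpret graph G by fact
  have G: "card (verts G) \<ge> 3" "biconn_on (arcs_ends G) (verts G)"
    using connectivity_ge_2_iff[OF assms(1), of "{}"] assms(2)
    by (simp_all add: delete_verts_empty[OF assms(1)] k_connected_def)
  interpret T: triangle_free_2conn "verts G" "arcs_ends G"
  proof
    show "sym (arcs_ends G)"
      using sym_arcs by (simp add: symmetric_def)
    show "card (arcs_ends G `` {v}) \<ge> 3" if "v \<in> verts G" for v
      using card_nbrs_ge_min_degree[OF assms(1) that] assms(4) by simp
    show "(w, u) \<notin> arcs_ends G" if "(u, v) \<in> arcs_ends G" "(v, w) \<in> arcs_ends G" for u v w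
      using assms(3) that unfolding triangle_free_def by blast
  qed (use G in \<open>auto simp: biconn_on_def dest: adj_in_verts\<close>)
  obtain x y where xy: "(x, y) \<in> arcs_ends G" "biconn_on (arcs_ends G) (verts G - {x, y})"
    using T.biconn_edge_deletion .
  have "card (verts G - {x, y}) \<ge> 3"
    using T.card_delete_edge xy(1) .
  with xy connectivity_ge_2_iff[OF assms(1)] show ?thesis
    by blast
qed

end
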